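(* Let $k,m,n\in\mathbb{Z}$ and $N=\begin{pmatrix}16k+8&2m+1\\0&16n+8\end{pmatrix}\in UT_2(\mathbb{Z})$. Then there are no four matrices in $UT_2(\mathbb{Z})$ having the Jordan $D(N)$-property. Consequently, there is no upper-triangular Jordan $D(N)$-quadruple.
   Context: $UT_2(\mathbb{Z})$ denotes the ring of upper-triangular $2\times 2$ integer matrices, and $A\circ B=\frac12(AB+BA)$ (computed over $\mathbb{Q}$) is the Jordan product. For $N\in UT_2(\mathbb{Z})$, four matrices $A_1,A_2,A_3,A_4\in UT_2(\mathbb{Z})$ (not necessarily distinct or nonzero) have the Jordan $D(N)$-property if for every $1\le i<j\le 4$ there exists $X_{ij}\in UT_2(\mathbb{Z})$ with $A_i\circ A_j+N=X_{ij}^2$. If moreover the $A_i$ are distinct and nonzero, then $\{A_1,A_2,A_3,A_4\}$ is called an upper-triangular Jordan $D(N)$-quadruple. *)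

theory Defs
  imports Complex_Main "Jordan_Normal_Form.Matrix"
begin

definition UT2 :: "int mat set" where
  "UT2 = {A \<in> carrier_mat 2 2. upper_triangular A}"

definition jordan_prod :: "rat mat \<Rightarrow> rat mat \<Rightarrow> rat mat" where
  "jordan_prod A B = (1 / 2) \<cdot>\<^sub>m (A * B + B * A)"

(* The Jordan product of two integer matrices may have half-integral entries, so the
   equation is stated between rational matrices, while X itself must be integral.
   Only the values of A on {1..4} matter. *)
definition jordan_D_property :: "int mat \<Rightarrow> (nat \<Rightarrow> int mat) \<Rightarrow> bool" where
  "jordan_D_property N A \<longleftrightarrow>
     (\<forall>i\<in>{1..4}. A i \<in> UT2) \<and>
     (\<forall>i j. 1 \<le> i \<and> i < j \<and> j \<le> 4 \<longrightarrow>
       (\<exists>X\<in>UT2. jordan_prod (map_mat rat_of_int (A i)) (map_mat rat_of_int (A j))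
                   + map_mat rat_of_int N = map_mat rat_of_int (X ^\<^sub>m 2)))"

definition jordan_D_quadruple :: "int mat \<Rightarrow> int mat set \<Rightarrow> bool" where
  "jordan_D_quadruple N S \<longleftrightarrow>
     (\<exists>A. S = A ` {1..4} \<and> jordan_D_property N A \<and>
          inj_on A {1..4} \<and> (\<forall>i\<in>{1..4}. A i \<noteq> 0\<^sub>m 2 2))"

end

theory Submission
  imports Defs
begin

text \<open>
  Write \<open>a i\<close>, \<open>b i\<close>, \<open>c i\<close> for the entries of \<open>A i\<close> at positions \<open>(0,0)\<close>, \<open>(0,1)\<close>,
  \<open>(1,1)\<close>. The obstruction is purely 2-adic and comes from playing the diagonal against
  the corner entry.

  On the diagonal, each of the families \<open>a\<close> and \<open>c\<close> satisfies the scalar condition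
  that \<open>a i * a j + 8\<close> is a square modulo 16. This condition allows at most one even
  member (\<open>at_most_one_even\<close>), and any two odd members are congruent modulo 4
  (\<open>cong_mod_4_if_odd\<close>). Integer quadruples of this kind exist modulo 16, so the diagonal
  alone gives no contradiction.

  In the corner, \<open>b j * (a i + c i) + b i * (a j + c j) + 2 * (2 * m + 1)\<close> equals
  \<open>2 * y * (x + z)\<close>, where \<open>x\<close> and \<open>z\<close> are the diagonal entries of the root. Call an index
  odd if \<open>a i\<close> and \<open>c i\<close> are both odd. For two odd indices, \<open>x + z\<close> is even and the two
  traces are even and congruent modulo 4, so reduction modulo 4 forces \<open>b i\<close> and \<open>b j\<close> to
  have different parities (\<open>corner_parities_differ\<close>). Hence at most two indices are odd. As
  \<open>a\<close> and \<open>c\<close> have at most one even member each, exactly two indices are odd, and at each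
  of the other two just one of the diagonal entries is even, so the trace is odd there. Pairing
  such an index with an odd one gives, modulo 2, that \<open>b\<close> is even at the odd index
  (\<open>corner_even\<close>). So \<open>b\<close> is even at both odd indices, contrary to their different
  parities.
\<close>

section \<open>The diagonal modulo 16\<close>

text \<open>
  The squares modulo 16 are 0, 1, 4 and 9; subtracting 8 gives the possible residues of the
  products of diagonal entries.
\<close>

lemma product_residues:
  fixes p q k x :: int
  assumes "p * q + (16 * k + 8) = x ^ 2"
  shows "p * q mod 16 \<in> {1, 8, 9, 12}"
proof -
  have "x mod 16 \<in> {0..15}" by simp
  then have "x mod 16 \<in> set [0..15]" by simp
  then have "(x mod 16) ^ 2 mod 16 \<in> {0, 1, 4, 9}"
    by (auto simp: upto.simps)
  then have "x ^ 2 mod 16 \<in> {0, 1, 4, 9}"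
    by (simp add: power_mod)
  then have "(p * q + (16 * k + 8)) mod 16 \<in> {0, 1, 4, 9}"
    unfolding assms .
  moreover have "(p * q + (16 * k + 8)) mod 16 = (p * q mod 16 + 8) mod 16"
    using mod_mult_self1[of "p * q + 8" k 16] by (simp add: mod_simps algebra_simps)
  moreover have "p * q mod 16 \<in> set [0..15]" by simp
  ultimately show ?thesis
    by (auto simp: upto.simps)
qed

lemma residue_mod_4:
  fixes v :: int
  assumes "v mod 16 \<in> {1, 8, 9, 12}"
  shows "v mod 4 = (if even v then 0 else 1)"
proof -
  have "v mod 4 = v mod 16 mod 4" by (simp add: mod_mod_cancel)
  moreover have "even v \<longleftrightarrow> even (v mod 16)" by (simp add: dvd_mod_iff)
  ultimately show ?thesis using assms by auto
qed

lemma cong_mod_4_if_odd: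
  fixes p q :: int
  assumes "p * q mod 16 \<in> {1, 8, 9, 12}" "odd p" "odd q"
  shows "p mod 4 = q mod 4"
proof -
  have "odd (p * q)" using assms by simp
  with residue_mod_4[OF assms(1)] have "p * q mod 4 = 1" by presburger
  then have "(p mod 4) * (q mod 4) mod 4 = 1" by (simp add: mod_mult_eq)
  moreover have "p mod 4 \<in> {1, 3}" "q mod 4 \<in> {1, 3}"
    using assms(2,3) by simp_all presburger+
  ultimately show ?thesis by auto
qed

text \<open>
  Halving an even family turns the condition modulo 16 into one modulo 4: the product of two
  distinct members is 2 or 3 modulo 4. As squares are 0 or 1 modulo 4, the members lie in
  distinct residue classes; as the class 0 is excluded as well, there is no room for four.
\<close>

lemma no_even_quadruple:
  fixes a :: "nat \<Rightarrow> int"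
  assumes res: "\<And>i j. \<lbrakk>i \<in> {1..4}; j \<in> {1..4}; i \<noteq> j\<rbrakk> \<Longrightarrow> a i * a j mod 16 \<in> {1, 8, 9, 12}"
    and even: "\<And>i. i \<in> {1..4} \<Longrightarrow> even (a i)"
  shows False
proof -
  define r where "r i = a i div 2 mod 4" for i
  have prod: "r i * r j mod 4 \<in> {2, 3}" if ij: "i \<in> {1..4}" "j \<in> {1..4}" "i \<noteq> j" for i j
  proof -
    obtain u v where "a i = 2 * u" "a j = 2 * v"
      using even[OF ij(1)] even[OF ij(2)] by (auto elim!: evenE)
    then have "a i * a j = 4 * (a i div 2 * (a j div 2))" by simp
    moreover have "w mod 4 \<in> {2, 3}" if "4 * w mod 16 \<in> {1, 8, 9, 12}" for w :: int
      using that by (simp only: insert_iff empty_iff) presburger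
    ultimately have "a i div 2 * (a j div 2) mod 4 \<in> {2, 3}"
      using res[OF ij] by metis
    then show ?thesis by (simp add: r_def mod_mult_eq)
  qed
  have range: "r i \<in> {0, 1, 2, 3}" for i
    unfolding r_def by simp presburger
  have "inj_on r {1..4}"
  proof (rule inj_onI, rule ccontr)
    fix i j :: nat assume ij: "i \<in> {1..4}" "j \<in> {1..4}" "r i = r j" "i \<noteq> j"
    with prod[of i j] range[of i] show False by auto
  qed
  moreover have "r ` {1..4} \<subseteq> {1, 2, 3}"
  proof
    fix v assume "v \<in> r ` {1..4}"
    then obtain i where i: "i \<in> {1..4}" "v = r i" by blast
    define j :: nat where "j = (if i = 1 then 2 else 1)"
    have "j \<in> {1..4}" "i \<noteq> j" by (auto simp: j_def)
    with prod[of i j] range[of i] i show "v \<in> {1, 2, 3}" by auto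
  qed
  ultimately have "card {1..4::nat} \<le> card {1, 2, 3 :: int}"
    by (intro card_inj_on_le) auto
  then show False by simp
qed

text \<open>
  Two even members cannot both be divisible by 4, so one of them is 2 modulo 4. A product of
  this member with an odd one would be 2 modulo 4, which is not an admissible residue; thus all
  members would be even.
\<close>

lemma at_most_one_even:
  fixes a :: "nat \<Rightarrow> int"
  assumes res: "\<And>i j. \<lbrakk>i \<in> {1..4}; j \<in> {1..4}; i \<noteq> j\<rbrakk> \<Longrightarrow> a i * a j mod 16 \<in> {1, 8, 9, 12}"
    and ij: "i \<in> {1..4}" "j \<in> {1..4}" "i \<noteq> j"
  shows "odd (a i) \<or> odd (a j)"
proof (rule ccontr)
  assume "\<not> (odd (a i) \<or> odd (a j))"
  then have ev: "even (a i)" "even (a j)" by auto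
  have "\<not> (4 dvd a i \<and> 4 dvd a j)"
  proof
    assume "4 dvd a i \<and> 4 dvd a j"
    then have "4 * 4 dvd a i * a j" by (intro mult_dvd_mono) auto
    with res[OF ij] show False by auto
  qed
  then obtain p where p: "p \<in> {1..4}" "even (a p)" "\<not> 4 dvd a p"
    using ij ev by blast
  have "even (a l)" if "l \<in> {1..4}" for l
  proof (rule ccontr)
    assume "odd (a l)"
    with p have "p \<noteq> l" by auto
    have "even (a p * a l)" using p by simp
    with residue_mod_4[OF res[OF p(1) that \<open>p \<noteq> l\<close>]] have "4 dvd a p * a l" by presburger
    moreover have "coprime (2 ^ 2) (a l)" using \<open>odd (a l)\<close> by (simp only: coprime_power_left_iff) simp
    ultimately have "4 dvd a p" by (simp add: coprime_dvd_mult_left_iff)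
    with p show False by simp
  qed
  with res show False by (rule no_even_quadruple)
qed

section \<open>The corner modulo 4\<close>

lemma odd_root:
  fixes p q k x :: int
  assumes "p * q + (16 * k + 8) = x ^ 2" "odd p" "odd q"
  shows "odd x"
proof -
  have "odd (p * q + (16 * k + 8))" using assms(2,3) by simp
  then show ?thesis unfolding assms(1) by simp
qed

text \<open>
  Both traces are even and \<open>p + r\<close>, \<open>q + s\<close> agree modulo 4, so the corner equation, divided
  by 2, reads \<open>(b + d) * ((p + r) div 2) \<equiv> 1\<close> modulo 2.
\<close>

lemma corner_parities_differ:
  fixes p q r s b d m x y z :: int
  assumes corner: "d * (p + r) + b * (q + s) + 2 * (2 * m + 1) = 2 * y * (x + z)"
    and "even (x + z)" "even (p + r)"
    and "p mod 4 = q mod 4" "r mod 4 = s mod 4"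
  shows "odd b \<longleftrightarrow> even d"
proof -
  obtain w where w: "x + z = 2 * w" using assms(2) by blast
  obtain t where t: "p + r = 2 * t" using assms(3) by blast
  have "(q + s) mod 4 = (p + r) mod 4" using assms(4,5) by (metis mod_add_cong)
  then obtain u where u: "q + s = p + r + 4 * u" by (metis mod_eqE)
  have "2 * ((b + d) * t + 2 * b * u + 2 * m + 1) = 2 * (2 * y * w)"
    using corner unfolding u w t by (simp add: algebra_simps)
  then have "(b + d) * t = 2 * (y * w - b * u - m) - 1"
    by (simp add: algebra_simps)
  then have "odd ((b + d) * t)" by simp
  then show ?thesis by simp
qed

lemma corner_even:
  fixes t t' b d m w :: int
  assumes "d * t + b * t' + 2 * (2 * m + 1) = 2 * w" "even t" "odd t'"
  shows "even b"
proof -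
  have "even (d * t + b * t' + 2 * (2 * m + 1))" unfolding assms(1) by simp
  with assms(2,3) show ?thesis by simp
qed

section \<open>Parity patterns of the four matrices\<close>

text \<open>
  The conflict between diagonal and corner, stated for the entries. As the equations are
  symmetric in \<open>i\<close> and \<open>j\<close>, they are assumed for all pairs of distinct indices rather than for
  \<open>i < j\<close>, which lets the argument pick indices by parity alone.
\<close>

lemma no_entries:
  fixes a b c :: "nat \<Rightarrow> int" and k m n :: int
  assumes eqs: "\<And>i j. \<lbrakk>i \<in> {1..4}; j \<in> {1..4}; i \<noteq> j\<rbrakk> \<Longrightarrow>
    \<exists>x y z. a i * a j + (16 * k + 8) = x ^ 2 \<and> c i * c j + (16 * n + 8) = z ^ 2 \<and>
      b j * (a i + c i) + b i * (a j + c j) + 2 * (2 * m + 1) = 2 * y * (x + z)"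
  shows False
proof -
  have resa: "a i * a j mod 16 \<in> {1, 8, 9, 12}"
    and resc: "c i * c j mod 16 \<in> {1, 8, 9, 12}"
    if "i \<in> {1..4}" "j \<in> {1..4}" "i \<noteq> j" for i j
    using eqs[OF that] product_residues by blast+
  have a_odd: "odd (a i) \<or> odd (a j)" and c_odd: "odd (c i) \<or> odd (c j)"
    if "i \<in> {1..4}" "j \<in> {1..4}" "i \<noteq> j" for i j
    using at_most_one_even[of a, OF resa that] at_most_one_even[of c, OF resc that] by blast+
  define P where "P i \<longleftrightarrow> odd (a i) \<and> odd (c i)" for i
  have differ: "odd (b i) \<longleftrightarrow> even (b j)"
    if ij: "i \<in> {1..4}" "j \<in> {1..4}" "i \<noteq> j" and P: "P i" "P j" for i j
  proof -
    obtain x y z where e: "a i * a j + (16 * k + 8) = x ^ 2" "c i * c j + (16 * n + 8) = z ^ 2"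
      "b j * (a i + c i) + b i * (a j + c j) + 2 * (2 * m + 1) = 2 * y * (x + z)"
      using eqs[OF ij] by blast
    have "odd x" "odd z" using odd_root e(1,2) P unfolding P_def by blast+
    then show ?thesis
      using P cong_mod_4_if_odd[OF resa[OF ij]] cong_mod_4_if_odd[OF resc[OF ij]]
      by (intro corner_parities_differ[OF e(3)]) (auto simp: P_def)
  qed
  have even_b: "even (b i)"
    if ij: "i \<in> {1..4}" "j \<in> {1..4}" "i \<noteq> j" and P: "P i" "odd (a j + c j)" for i j
  proof -
    obtain x y z where corner:
      "b j * (a i + c i) + b i * (a j + c j) + 2 * (2 * m + 1) = 2 * (y * (x + z))"
      using eqs[OF ij] by (auto simp: mult.assoc)
    show ?thesis using P by (intro corner_even[OF corner]) (auto simp: P_def)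
  qed
  have no_three: "\<not> (P i \<and> P j \<and> P l)"
    if "i \<in> {1..4}" "j \<in> {1..4}" "l \<in> {1..4}" "i \<noteq> j" "i \<noteq> l" "j \<noteq> l" for i j l
    using differ that by metis
  \<comment> \<open>Among any three indices \<open>P\<close> fails at one, so it fails at two of the four.\<close>
  obtain p q where pq: "p \<in> {1..4}" "q \<in> {1..4}" "p \<noteq> q" "\<not> P p" "\<not> P q"
  proof -
    obtain p where p: "p \<in> {1, 2, 3}" "\<not> P p"
      using no_three[of 1 2 3] by auto
    have "\<not> (P 2 \<and> P 3 \<and> P 4)" "\<not> (P 1 \<and> P 3 \<and> P 4)" "\<not> (P 1 \<and> P 2 \<and> P 4)"
      by (rule no_three; simp)+
    moreover have "p = 1 \<or> p = 2 \<or> p = 3" using p(1) by blast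
    ultimately have "\<exists>q\<in>{1, 2, 3, 4}. q \<noteq> p \<and> \<not> P q" by (elim disjE) simp_all
    then obtain q where "q \<in> {1, 2, 3, 4}" "q \<noteq> p" "\<not> P q" by blast
    with p show ?thesis by (intro that[of p q]) auto
  qed
  \<comment> \<open>One of the two has its even entry in \<open>a\<close> and the other in \<open>c\<close>, which uses up both.\<close>
  have trace: "odd (a p + c p)"
    using pq a_odd[OF pq(1-3)] c_odd[OF pq(1-3)] unfolding P_def by auto
  have rest: "P l" if "l \<in> {1..4}" "l \<noteq> p" "l \<noteq> q" for l
    using pq that a_odd[of p q] c_odd[of p q] a_odd[of l p] a_odd[of l q] c_odd[of l p] c_odd[of l q]
    unfolding P_def by blast
  have "card ({1..4} - {p, q}) = 2"
    using pq by (subst card_Diff_subset) auto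
  then obtain i j where "{1..4} - {p, q} = {i, j}" "i \<noteq> j"
    by (auto simp: card_2_iff)
  then have ij: "i \<in> {1..4} - {p, q}" "j \<in> {1..4} - {p, q}" "i \<noteq> j" by auto
  have "even (b i)" "even (b j)"
    using even_b[of i p] even_b[of j p] rest ij pq trace by auto
  moreover have "odd (b i) \<longleftrightarrow> even (b j)"
    using differ rest ij by auto
  ultimately show False by simp
qed

section \<open>From matrices to entries\<close>

text \<open>
  Doubling the corner entry clears the factor 1/2 of the Jordan product, so that all three
  equations are integral.
\<close>

lemma jordan_square_entries:
  fixes A B X N :: "int mat"
  assumes AB: "A \<in> UT2" "B \<in> UT2" and X: "X \<in> UT2" and N: "N \<in> carrier_mat 2 2"
    and eq: "jordan_prod (map_mat rat_of_int A) (map_mat rat_of_int B) + map_mat rat_of_int N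
      = map_mat rat_of_int (X ^\<^sub>m 2)"
  shows "A $$ (0,0) * B $$ (0,0) + N $$ (0,0) = (X $$ (0,0)) ^ 2"
    and "A $$ (1,1) * B $$ (1,1) + N $$ (1,1) = (X $$ (1,1)) ^ 2"
    and "B $$ (0,1) * (A $$ (0,0) + A $$ (1,1)) + A $$ (0,1) * (B $$ (0,0) + B $$ (1,1))
      + 2 * N $$ (0,1) = 2 * X $$ (0,1) * (X $$ (0,0) + X $$ (1,1))"
proof -
  have dims: "A \<in> carrier_mat 2 2" "B \<in> carrier_mat 2 2" "X \<in> carrier_mat 2 2"
    and low: "A $$ (1,0) = 0" "B $$ (1,0) = 0" "X $$ (1,0) = 0"
    using AB X by (auto simp: UT2_def upper_triangular_def)
  have low': "A $$ (Suc 0,0) = 0" "B $$ (Suc 0,0) = 0" "X $$ (Suc 0,0) = 0"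
    using low by simp_all
  have ent: "(jordan_prod (map_mat rat_of_int A) (map_mat rat_of_int B) + map_mat rat_of_int N) $$ ij
      = map_mat rat_of_int (X ^\<^sub>m 2) $$ ij" for ij
    by (simp only: eq)
  have "rat_of_int (A $$ (0,0) * B $$ (0,0) + N $$ (0,0)) = rat_of_int ((X $$ (0,0)) ^ 2)"
    using ent[of "(0,0)"] dims N low'
    by (simp add: jordan_prod_def scalar_prod_def numeral_2_eq_2)
  then show "A $$ (0,0) * B $$ (0,0) + N $$ (0,0) = (X $$ (0,0)) ^ 2"
    by (simp only: of_int_eq_iff)
  have "rat_of_int (A $$ (1,1) * B $$ (1,1) + N $$ (1,1)) = rat_of_int ((X $$ (1,1)) ^ 2)"
    using ent[of "(1,1)"] dims N low'
    by (simp add: jordan_prod_def scalar_prod_def numeral_2_eq_2)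
  then show "A $$ (1,1) * B $$ (1,1) + N $$ (1,1) = (X $$ (1,1)) ^ 2"
    by (simp only: of_int_eq_iff)
  have "rat_of_int (B $$ (0,1) * (A $$ (0,0) + A $$ (1,1)) + A $$ (0,1) * (B $$ (0,0) + B $$ (1,1))
      + 2 * N $$ (0,1)) = rat_of_int (2 * X $$ (0,1) * (X $$ (0,0) + X $$ (1,1)))"
    using ent[of "(0,1)"] dims N low'
    by (simp add: jordan_prod_def scalar_prod_def numeral_2_eq_2 field_simps)
  then show "B $$ (0,1) * (A $$ (0,0) + A $$ (1,1)) + A $$ (0,1) * (B $$ (0,0) + B $$ (1,1))
      + 2 * N $$ (0,1) = 2 * X $$ (0,1) * (X $$ (0,0) + X $$ (1,1))"
    by (simp only: of_int_eq_iff)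
qed

theorem proposition18:
  fixes k m n :: int and N :: "int mat"
  assumes "N = mat_of_rows_list 2 [[16 * k + 8, 2 * m + 1], [0, 16 * n + 8]]"
  shows "\<not> (\<exists>A. jordan_D_property N A) \<and> \<not> (\<exists>S. jordan_D_quadruple N S)"
proof -
  have N: "N \<in> carrier_mat 2 2" "N $$ (0,0) = 16 * k + 8" "N $$ (0,1) = 2 * m + 1"
    "N $$ (1,1) = 16 * n + 8"
    unfolding assms mat_of_rows_list_def by (auto simp: numeral_2_eq_2)
  have "False" if A: "jordan_D_property N A" for A
  proof -
    let ?E = "\<lambda>i j. \<exists>x y z. A i $$ (0,0) * A j $$ (0,0) + (16 * k + 8) = x ^ 2 \<and>
      A i $$ (1,1) * A j $$ (1,1) + (16 * n + 8) = z ^ 2 \<and>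
      A j $$ (0,1) * (A i $$ (0,0) + A i $$ (1,1)) + A i $$ (0,1) * (A j $$ (0,0) + A j $$ (1,1))
        + 2 * (2 * m + 1) = 2 * y * (x + z)"
    have less: "?E i j" if ij: "i \<in> {1..4}" "j \<in> {1..4}" "i < j" for i j
    proof -
      have U: "A i \<in> UT2" "A j \<in> UT2" using A ij unfolding jordan_D_property_def by auto
      obtain X where X: "X \<in> UT2" "jordan_prod (map_mat rat_of_int (A i)) (map_mat rat_of_int (A j))
          + map_mat rat_of_int N = map_mat rat_of_int (X ^\<^sub>m 2)"
      proof -
        have "1 \<le> i \<and> i < j \<and> j \<le> 4" using ij by simp
        with A that show ?thesis unfolding jordan_D_property_def by blast
      qed
      show ?thesis using jordan_square_entries[OF U X(1) N(1) X(2)] unfolding N by blast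
    qed
    have "?E i j" if ij: "i \<in> {1..4}" "j \<in> {1..4}" "i \<noteq> j" for i j
    proof (cases "i < j")
      case True
      with less ij show ?thesis by blast
    next
      case False
      with less[of j i] ij show ?thesis by (simp add: mult.commute add.commute)
    qed
    then show False by (rule no_entries)
  qed
  then show ?thesis unfolding jordan_D_quadruple_def by blast
qed

end
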